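(* For all integers $n\ge 1$ and $1\le k\le 2n-1$, $$T(n,k)=\#\{\pi\in\Phi(\mathcal{Q}_n)\mid \mathrm{altrun}(\pi)=k\}.$$
   Context: Definition of $T(n,k)$: let $\vartheta=x\frac{d}{dx}$ and $r(x)=\frac{\sqrt{1+x}}{\sqrt{1-x}}$. For $n\ge 1$ there are (uniquely determined) positive integers $T(n,k)$, $1\le k\le 2n-1$, such that $$\vartheta^n(r(x))=\frac{\sum_{k=1}^{2n-1}T(n,k)x^k}{(1-x)^n(1+x)^{n-1}\sqrt{1-x^2}}.$$ A Stirling permutation of order $n$ is a permutation $\sigma=\sigma(1)\sigma(2)\cdots\sigma(2n)$ of the multiset $\{1,1,2,2,\ldots,n,n\}$ such that for each $i$, $1\le i\le n$, all entries between the two occurrences of $i$ are larger than $i$. $\mathcal{Q}_n$ denotes the set of Stirling permutations of order $n$. $\Phi$ is the injection from $\mathcal{Q}_n$ into the symmetric group $\mathfrak{S}_{2n}$ (permutations of $\{1,\ldots,2n\}$ written as words) that replaces, for each $j\in\{1,\ldots,n\}$, the first occurrence of $j$ in $\sigma$ by $2j$ and the second occurrence of $j$ by $2j-1$; e.g. $\Phi(221331)=432651$. The dual set is $\Phi(\mathcal{Q}_n)=\{\Phi(\sigma)\mid \sigma\in\mathcal{Q}_n\}\subseteq\mathfrak{S}_{2n}$. A permutation $\pi=\pi(1)\cdots\pi(m)\in\mathfrak{S}_m$ changes direction at position $i\in\{2,\ldots,m-1\}$ if $\pi(i-1)<\pi(i)>\pi(i+1)$ or $\pi(i-1)>\pi(i)<\pi(i+1)$.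 For $m\ge2$, $\pi$ has $k$ alternating runs, written $\mathrm{altrun}(\pi)=k$, if there are exactly $k-1$ positions at which $\pi$ changes direction. *)

theory Defs
  imports "HOL-Analysis.Analysis"
begin

definition vartheta :: "(real \<Rightarrow> real) \<Rightarrow> real \<Rightarrow> real" where
  "vartheta f = (\<lambda>x. x * deriv f x)"

definition r :: "real \<Rightarrow> real" where
  "r x = sqrt (1 + x) / sqrt (1 - x)"

(* The numerator coefficients are indexed by 1..2n-1; they are extended by 0 outside this
   range so that the whole function t is uniquely determined. The identity is one of functions
   on (-1, 1), the interval where r and the square root in the denominator are differentiable. *)
definition is_T_row :: "nat \<Rightarrow> (nat \<Rightarrow> nat) \<Rightarrow> bool" where
  "is_T_row n t \<longleftrightarrow>
     (\<forall>k\<in>{1..2 * n - 1}. 0 < t k) \<and>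
     (\<forall>k. k \<notin> {1..2 * n - 1} \<longrightarrow> t k = 0) \<and>
     (\<forall>x\<in>{-1<..<1::real}.
        (vartheta ^^ n) r x =
          (\<Sum>k=1..2 * n - 1. real (t k) * x ^ k)
            / ((1 - x) ^ n * (1 + x) ^ (n - 1) * sqrt (1 - x\<^sup>2)))"

definition T :: "nat \<Rightarrow> nat \<Rightarrow> nat" where
  "T n = (THE t. is_T_row n t)"

(* Permutations of multisets are words, represented as lists; the entry written \<sigma>(i) is
   \<sigma> ! (i - 1). *)

definition stirling_perms :: "nat \<Rightarrow> nat list set" where
  "stirling_perms n =
     {\<sigma>. mset \<sigma> = mset [1..<n + 1] + mset [1..<n + 1] \<and>
          (\<forall>p m q. p < m \<and> m < q \<and> q < length \<sigma> \<and> \<sigma> ! p = \<sigma> ! q \<longrightarrow> \<sigma> ! m > \<sigma> ! p)}"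

definition Phi :: "nat list \<Rightarrow> nat list" where
  "Phi \<sigma> = map (\<lambda>p. if \<sigma> ! p \<in> set (take p \<sigma>) then 2 * \<sigma> ! p - 1 else 2 * \<sigma> ! p)
             [0..<length \<sigma>]"

lemma "Phi [2, 2, 1, 3, 3, 1] = [4, 3, 2, 6, 5, 1]"
  by code_simp

(* i is a 0-based position, so the first and the last entry are excluded. *)
definition changes_direction :: "nat list \<Rightarrow> nat \<Rightarrow> bool" where
  "changes_direction \<pi> i \<longleftrightarrow>
     0 < i \<and> i + 1 < length \<pi> \<and>
     (\<pi> ! (i - 1) < \<pi> ! i \<and> \<pi> ! i > \<pi> ! (i + 1) \<or>
      \<pi> ! (i - 1) > \<pi> ! i \<and> \<pi> ! i < \<pi> ! (i + 1))"

(* Only meaningful for words of length at least 2. *)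
definition altrun :: "nat list \<Rightarrow> nat" where
  "altrun \<pi> = card {i. changes_direction \<pi> i} + 1"

end

theory Submission
  imports Defs
begin

text \<open>
  Both sides of the identity obey the same recurrence, and the analytic side and the combinatorial
  side are compared through generating polynomials instead of coefficient by coefficient.

  A Stirling permutation of order \<open>n + 1\<close> arises from exactly one of order \<open>n\<close> by inserting the
  adjacent pair \<open>n + 1, n + 1\<close> anywhere, since nothing larger could separate the two copies. Under
  \<open>Phi\<close> this becomes the insertion of the descending pair \<open>2 n + 2, 2 n + 1\<close>, both larger than
  everything else (\<open>dual_set_Suc\<close>). By induction, all nonempty words of the dual set end with a descent.
  In such a word with \<open>k\<close> alternating runs and length \<open>2 n\<close>, look at the up-down sequence of its consecutive
  entries. Inserting the pair in a gap replaces the letter of that gap by up-down-down. Next to an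
  existing peak this merely moves the peak and keeps the number of runs; elsewhere inside the word, and
  at its end, it creates a new peak and thereby two further runs. The beginning is special: if the word
  starts with an ascent, insertion in front adds one run; if it starts with a descent, insertion in
  front adds none and insertion in the first gap adds one. The outcome is (\<open>altrun_insertions\<close>): of the \<open>2 n + 1\<close>
  insertions, \<open>k\<close> keep the number of runs, one raises it by 1, and \<open>2 n - k\<close> raise it by 2.

  Consequently the polynomials \<open>P n = (\<Sum>w. x ^ altrun w)\<close> satisfy
  \<open>P (n + 1) = x (1 - x\<^sup>2) P' n + x (1 + 2 n x) P n\<close> (\<open>run_poly_Suc\<close>). On the other hand
  \<open>r' = r / (1 - x\<^sup>2)\<close>, so applying \<open>vartheta\<close> to \<open>P r / (1 - x\<^sup>2) ^ n\<close> transforms the numerator \<open>P\<close> by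
  the same rule (\<open>vartheta_power_r\<close>), and \<open>r / (1 - x\<^sup>2) ^ n\<close> is the reciprocal of the denominator in
  the definition of \<open>T\<close>. Hence the run counts form a row of \<open>T\<close>; their positivity also follows from the
  insertion count, and the row is unique because polynomials that agree on an interval have equal
  coefficients.
\<close>

section \<open>Turning points of words\<close>

fun turns :: "'a::linorder list \<Rightarrow> nat" where
  "turns (a # b # c # w) =
     (if a < b \<and> b > c \<or> a > b \<and> b < c then 1 else 0) + turns (b # c # w)"
| "turns _ = 0"

lemma turns_le: "turns w \<le> length w - 2"
  by (induction w rule: turns.induct) auto

text \<open>
  Removing the first letter shifts every position by one and forgets only the position 1, which is
  the recursion of \<open>turns\<close>.
\<close>
lemma card_changes_direction: "card {i. changes_direction w i} = turns w"
proof (induction w rule: turns.induct)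
  case (1 a b c w)
  let ?D = "\<lambda>v. {i. changes_direction v i}"
  let ?t = "a < b \<and> b > c \<or> a > b \<and> b < c"
  have split: "?D (a # b # c # w) = (if ?t then {1} else {}) \<union> Suc ` ?D (b # c # w)"
  proof (intro set_eqI)
    fix i
    show "i \<in> ?D (a # b # c # w) \<longleftrightarrow> i \<in> (if ?t then {1} else {}) \<union> Suc ` ?D (b # c # w)"
    proof (cases i)
      case 0
      then show ?thesis by (auto simp: changes_direction_def)
    next
      case (Suc j)
      then show ?thesis
        by (cases j) (auto simp: changes_direction_def inj_image_mem_iff)
    qed
  qed
  have fin: "finite (?D (b # c # w))"
    by (rule finite_subset[of _ "{..<length (b # c # w)}"]) (auto simp: changes_direction_def)
  have "1 \<notin> Suc ` ?D (b # c # w)"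
    by (auto simp: changes_direction_def)
  with fin 1 show ?case
    unfolding split by (simp add: card_image)
qed (auto simp: changes_direction_def)

lemma altrun_eq_Suc_turns: "altrun w = Suc (turns w)"
  by (simp add: altrun_def card_changes_direction)

text \<open>
  Words with fewer than two letters qualify by convention, so that the property is preserved by
  insertions starting from the empty word.
\<close>
fun final_descent :: "'a::linorder list \<Rightarrow> bool" where
  "final_descent [a, b] \<longleftrightarrow> b < a"
| "final_descent (a # b # c # w) \<longleftrightarrow> final_descent (b # c # w)"
| "final_descent _ \<longleftrightarrow> True"

lemma final_descent_Cons: "length w \<ge> 2 \<Longrightarrow> final_descent (a # w) \<longleftrightarrow> final_descent w"
  by (cases w rule: final_descent.cases) auto

section \<open>Inserting a block into a word\<close>

fun insertions :: "'a list \<Rightarrow> 'a list \<Rightarrow> 'a list list" where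
  "insertions p [] = [p]"
| "insertions p (a # w) = (p @ a # w) # map (Cons a) (insertions p w)"

lemma set_insertions: "set (insertions p w) = {u @ p @ v | u v. w = u @ v}"
proof (induction w)
  case (Cons a w)
  show ?case
  proof (intro set_eqI iffI)
    fix t assume "t \<in> set (insertions p (a # w))"
    then consider "t = p @ a # w" | u v where "w = u @ v" "t = a # u @ p @ v"
      using Cons by auto
    then show "t \<in> {u @ p @ v | u v. a # w = u @ v}"
    proof cases
      case 1
      then show ?thesis unfolding mem_Collect_eq by (metis append_Nil)
    next
      case 2
      then show ?thesis unfolding mem_Collect_eq by (metis append_Cons)
    qed
  next
    fix t assume "t \<in> {u @ p @ v | u v. a # w = u @ v}"
    then show "t \<in> set (insertions p (a # w))"
      unfolding mem_Collect_eq insertions.simps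
      by (auto simp: Cons_eq_append_conv Cons image_iff) blast+
  qed
qed auto

lemma distinct_insertions: "M \<notin> set w \<Longrightarrow> distinct (insertions (M # p) w)"
  by (induction w) (auto simp: distinct_map)

lemma mset_insertions: "t \<in> set (insertions p w) \<Longrightarrow> mset t = mset p + mset w"
  by (auto simp: set_insertions)

text \<open>
  The inserted block can be erased again. This is what makes the sets of insertions into different
  words disjoint.
\<close>
lemma filter_insertions:
  assumes "t \<in> set (insertions p w)" "\<forall>x\<in>set p. \<not> Q x" "\<forall>x\<in>set w. Q x"
  shows "filter Q t = w"
  using assms by (auto simp: set_insertions)

lemma final_descent_insertions:
  assumes "t \<in> set (insertions [M, M'] w)" "M' < M" "\<forall>x\<in>set w. x < M'" "final_descent w"
  shows "final_descent t"
  using assms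
proof (induction w arbitrary: t rule: final_descent.induct)
  case (2 a b c w)
  consider "t = [M, M'] @ a # b # c # w"
    | t' where "t = a # t'" "t' \<in> set (insertions [M, M'] (b # c # w))"
    using "2.prems"(1) by auto
  then show ?case
  proof cases
    case 1
    then show ?thesis using 2 by simp
  next
    case 2
    have "final_descent t'"
      using "2.IH"[of t'] 2 "2.prems" by auto
    moreover have "length t' \<ge> 2"
      using mset_insertions[OF 2(2)] by (metis le_add1 length_Cons list.size(3) mset_append
          numeral_2_eq_2 size_mset size_union)
    ultimately show ?thesis
      using 2 by (simp add: final_descent_Cons)
  qed
qed auto

section \<open>How an insertion changes the number of alternating runs\<close>

text \<open>
  The insertion count for the places behind the first letter, with \<open>c\<close> the number of turning points;
  the place in front of the word is treated separately because this form is stable under induction.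
  Write U and D for an ascent and a descent. Replacing a letter by UDD does not change the number of
  turns when the letter is one of the two in a factor UD, and it adds two turns otherwise, except that
  it adds one turn to an initial D. As the word ends with D, the factors UD account for \<open>c + 1\<close>
  letters if it begins with U, and for \<open>c\<close> letters if it begins with D. The place at the very end
  appends UD behind a D and adds two turns.
\<close>
lemma turns_insertions_after_first:
  assumes "distinct (a # b # w)" "\<forall>x\<in>set (a # b # w). x < M'" "M' < M"
    and "final_descent (a # b # w)"
  shows "mset (map (\<lambda>t. turns (a # t)) (insertions [M, M'] (b # w))) =
    (let c = turns (a # b # w) in
      (if a < b then replicate_mset (c + 1) c else add_mset (c + 1) (replicate_mset c c))
      + replicate_mset (length w + 1 - c) (c + 2))"
  using assms
proof (induction w arbitrary: a b)
  case Nil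
  then have "a < M'" "b < M'" "b < a" "a < M" "b < M" by auto
  with \<open>M' < M\<close> show ?case by (auto simp: Let_def not_less_iff_gr_or_eq)
next
  case (Cons d w)
  define c where "c = turns (b # d # w)"
  (* X collects the insertions behind d. Such words still begin with b, d, so putting a in front
     shifts the values in X by 1 or 0 according to whether b is a turning point between a and d. *)
  define X where "X = mset (map (\<lambda>t. turns (b # d # t)) (insertions [M, M'] w))"
  have lt: "a < M'" "b < M'" "d < M'" "a < M" "b < M" "d < M" "M' < M" and neq: "a \<noteq> b" "b \<noteq> d"
    using Cons.prems by auto
  have c_le: "c \<le> length w"
    using turns_le[of "b # d # w"] by (simp add: c_def)
  have IH: "add_mset (turns (b # M # M' # d # w)) X =
    (if b < d then replicate_mset (c + 1) c else add_mset (c + 1) (replicate_mset c c))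
      + replicate_mset (length w + 1 - c) (c + 2)"
    using Cons.IH[of b d] Cons.prems by (simp add: X_def c_def Let_def o_def)
  have whole: "turns (a # b # d # w) = (if (a < b) = (b < d) then c else c + 1)"
    using neq by (auto simp: c_def)
  have first: "turns (a # M # M' # b # d # w) = (if b < d then c + 2 else c + 1)"
    using lt neq by (auto simp: c_def)
  have second: "turns (a # b # M # M' # d # w) = (if a < b then 0 else 1) + turns (b # M # M' # d # w)"
    using lt neq by auto
  (* For b > d, the entry M' takes over the role of b in front of d, so M is the only new turn. *)
  have second_descent: "turns (b # M # M' # d # w) = c + 1" if "d < b"
    using that lt by (cases w) (auto simp: c_def)
  have rest: "mset (map (\<lambda>t. turns (a # b # d # t)) (insertions [M, M'] w)) =
      image_mset (\<lambda>j. (if (a < b) = (b < d) then 0 else 1) + j) X"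
    using neq by (auto simp: X_def multiset.map_comp o_def intro!: image_mset_cong)
  have total: "mset (map (\<lambda>t. turns (a # t)) (insertions [M, M'] (b # d # w))) =
      add_mset (if b < d then c + 2 else c + 1)
        (add_mset ((if a < b then 0 else 1) + turns (b # M # M' # d # w))
          (image_mset (\<lambda>j. (if (a < b) = (b < d) then 0 else 1) + j) X))"
    using rest first second by (simp add: o_def)
  show ?case
  proof (cases "b < d")
    case True
    (* Both a word b, d, ... and one with M inserted behind b go up after b, so the same shift
       applies to every insertion behind b. *)
    have "mset (map (\<lambda>t. turns (a # t)) (insertions [M, M'] (b # d # w))) =
      add_mset (c + 2) (image_mset (\<lambda>j. (if a < b then 0 else 1) + j)
        (add_mset (turns (b # M # M' # d # w)) X))"
      using True unfolding total by simp
    then show ?thesis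
      unfolding IH whole Let_def using True c_le by (auto simp: Suc_diff_le)
  next
    case False
    then have "d < b" using neq by auto
    then have "X = replicate_mset c c + replicate_mset (length w + 1 - c) (c + 2)"
      using IH False unfolding second_descent[OF \<open>d < b\<close>] by simp
    then show ?thesis
      unfolding total whole Let_def second_descent[OF \<open>d < b\<close>] using False c_le
      by (auto simp: Suc_diff_le)
  qed
qed

text \<open>
  Inserting in front of the word prefixes DD. This adds a turn exactly if the word begins with U, which
  evens out the difference between the two cases of the preceding count.
\<close>
lemma altrun_insertions:
  assumes "distinct w" "length w \<ge> 2" "\<forall>x\<in>set w. x < M'" "M' < M" "final_descent w"
  shows "image_mset altrun (mset (insertions [M, M'] w)) =
    add_mset (altrun w + 1) (replicate_mset (altrun w) (altrun w))
      + replicate_mset (length w - altrun w) (altrun w + 2)"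
proof -
  obtain a b v where w: "w = a # b # v"
    using assms(2) by (metis Suc_le_length_iff numeral_2_eq_2)
  define c where "c = turns (a # b # v)"
  have c_le: "c \<le> length v"
    using turns_le[of "a # b # v"] by (simp add: c_def)
  have front: "turns (M # M' # a # b # v) = (if a < b then c + 1 else c)"
    using assms by (auto simp: w c_def)
  have "image_mset altrun (mset (insertions [M, M'] w)) =
      image_mset Suc (image_mset turns (mset (insertions [M, M'] w)))"
    unfolding multiset.map_comp by (rule image_mset_cong) (simp add: altrun_eq_Suc_turns)
  also have "image_mset turns (mset (insertions [M, M'] w)) =
      add_mset (turns (M # M' # a # b # v))
        (mset (map (\<lambda>t. turns (a # t)) (insertions [M, M'] (b # v))))"
    by (simp add: w multiset.map_comp o_def del: turns.simps)
  also have "mset (map (\<lambda>t. turns (a # t)) (insertions [M, M'] (b # v))) =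
      (if a < b then replicate_mset (c + 1) c else add_mset (c + 1) (replicate_mset c c))
      + replicate_mset (length v + 1 - c) (c + 2)"
    using turns_insertions_after_first[of a b v M' M] assms unfolding w c_def Let_def by blast
  also have "\<dots> = (if a < b then replicate_mset (c + 1) c else add_mset (c + 1) (replicate_mset c c))
      + add_mset (c + 2) (replicate_mset (length v - c) (c + 2))"
    using c_le by (simp add: Suc_diff_le)
  finally have "image_mset altrun (mset (insertions [M, M'] w)) =
      add_mset (c + 2) (replicate_mset (c + 1) (c + 1)) + replicate_mset (length v + 1 - c) (c + 3)"
    unfolding front using c_le
    by (cases "a < b") (simp_all only: if_True if_False, simp_all add: Suc_diff_le numeral_3_eq_3)
  moreover have "altrun w = c + 1" "length w = length v + 2"
    by (simp_all add: w c_def altrun_eq_Suc_turns)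
  ultimately show ?thesis
    by (simp add: numeral_3_eq_3)
qed

section \<open>The dual set grows by inserting a descending pair\<close>

lemma stirling_perms_0: "stirling_perms 0 = {[]}"
  by (auto simp: stirling_perms_def)

text \<open>
  The two copies of the largest label \<open>n + 1\<close> must be adjacent, and since they are larger than all other
  entries, removing or inserting them does not affect the condition on the other labels.
\<close>
lemma stirling_perms_Suc:
  "stirling_perms (Suc n) = (\<Union>\<sigma>\<in>stirling_perms n. set (insertions [n + 1, n + 1] \<sigma>))"
proof (intro set_eqI iffI)
  fix t assume "t \<in> stirling_perms (Suc n)"
  then have mt: "mset t = add_mset (n + 1) (add_mset (n + 1) (mset [1..<n + 1] + mset [1..<n + 1]))"
    and nest: "\<And>p m q. p < m \<Longrightarrow> m < q \<Longrightarrow> q < length t \<Longrightarrow> t ! p = t ! q \<Longrightarrow> t ! m > t ! p"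
    by (auto simp: stirling_perms_def)
  have "n + 1 \<in> set t"
    using mt by (metis set_mset_mset union_single_eq_member)
  then obtain u rest where t: "t = u @ (n + 1) # rest" and u: "n + 1 \<notin> set u"
    by (metis split_list_first)
  have "count (mset t) (n + 1) = 2"
    unfolding mt by (simp add: count_eq_zero_iff)
  moreover have "count (mset t) (n + 1) = count (mset u) (n + 1) + 1 + count (mset rest) (n + 1)"
    by (simp add: t)
  moreover have "count (mset u) (n + 1) = 0"
    using u by (simp add: count_eq_zero_iff)
  ultimately have "count (mset rest) (n + 1) > 0"
    by linarith
  then have "n + 1 \<in># mset rest"
    by (simp only: count_greater_zero_iff)
  then obtain B v where rest: "rest = B @ (n + 1) # v"
    by (auto dest: split_list)
  (* Entries between the two copies of n + 1 would have to exceed n + 1. *)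
  have "B = []"
  proof (cases B)
    case (Cons b B')
    have "b \<in># mset t"
      by (simp add: t rest Cons)
    then have "b \<le> n + 1"
      unfolding mt by auto
    moreover have "t ! (length u + 1) > t ! length u"
      by (rule nest[of _ _ "length u + 1 + length B"]) (auto simp: t rest Cons nth_append)
    ultimately show ?thesis
      by (simp add: t rest Cons nth_append)
  qed simp
  then have t: "t = u @ [n + 1, n + 1] @ v"
    by (simp add: t rest)
  have "mset (u @ v) = mset [1..<n + 1] + mset [1..<n + 1]"
    using mt by (simp add: t)
  moreover have "(u @ v) ! m > (u @ v) ! p"
    if "p < m" "m < q" "q < length (u @ v)" "(u @ v) ! p = (u @ v) ! q" for p m q
  proof -
    (* ?s i is the position in t of the entry at position i of u @ v. *)
    let ?s = "\<lambda>i. if i < length u then i else i + 2"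
    have s: "t ! ?s i = (u @ v) ! i" for i
      by (auto simp: t nth_append)
    show ?thesis
      using nest[of "?s p" "?s m" "?s q"] that unfolding s by (auto simp: t split: if_splits)
  qed
  ultimately have "u @ v \<in> stirling_perms n"
    unfolding stirling_perms_def by blast
  then show "t \<in> (\<Union>\<sigma>\<in>stirling_perms n. set (insertions [n + 1, n + 1] \<sigma>))"
    using t by (auto simp: set_insertions)
next
  fix t assume "t \<in> (\<Union>\<sigma>\<in>stirling_perms n. set (insertions [n + 1, n + 1] \<sigma>))"
  then obtain u v where uv: "u @ v \<in> stirling_perms n" and t: "t = u @ [n + 1, n + 1] @ v"
    by (auto simp: set_insertions)
  have m: "mset (u @ v) = mset [1..<n + 1] + mset [1..<n + 1]"
    and nest: "\<And>p m q. p < m \<Longrightarrow> m < q \<Longrightarrow> q < length (u @ v) \<Longrightarrow> (u @ v) ! p = (u @ v) ! q \<Longrightarrow>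
        (u @ v) ! m > (u @ v) ! p"
    using uv by (auto simp: stirling_perms_def)
  have "(u @ v) ! i < n + 1" if "i < length (u @ v)" for i
  proof -
    have "(u @ v) ! i \<in># mset (u @ v)"
      using that by (metis nth_mem_mset)
    then show ?thesis
      unfolding m by auto
  qed
  note small = this
  (* ?s i is the position in u @ v of the entry of t at a position i that does not carry a new copy. *)
  let ?s = "\<lambda>i. if i < length u then i else i - 2"
  let ?new = "\<lambda>i. i = length u \<or> i = length u + 1"
  have new: "t ! i = n + 1" if "?new i" for i
    using that by (auto simp: t nth_append)
  have old: "t ! i = (u @ v) ! ?s i" "?s i < length (u @ v)" if "\<not> ?new i" "i < length t" for i
  proof -
    show "t ! i = (u @ v) ! ?s i"
      using that by (auto simp: t nth_append nth_Cons' numeral_2_eq_2)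
    show "?s i < length (u @ v)"
      using that by (auto simp: t)
  qed
  have "t ! m > t ! p" if pmq: "p < m" "m < q" "q < length t" "t ! p = t ! q" for p m q
  proof -
    have np: "\<not> ?new p"
    proof
      assume p: "?new p"
      then have "\<not> ?new q" using pmq by auto
      then show False
        using new[OF p] old[of q] small[of "?s q"] pmq by auto
    qed
    then have sp: "t ! p < n + 1"
      using old[of p] small[of "?s p"] pmq by auto
    then have nq: "\<not> ?new q"
      using new[of q] pmq by auto
    show ?thesis
    proof (cases "?new m")
      case True
      then show ?thesis using new[of m] sp by simp
    next
      case False
      have "?s p < ?s m" "?s m < ?s q"
        using np nq False pmq by auto
      then show ?thesis
        using nest[of "?s p" "?s m" "?s q"] old[of p] old[of m] old[of q] np nq False pmq by auto
    qed
  qed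
  moreover have "mset t = mset [1..<Suc n + 1] + mset [1..<Suc n + 1]"
    using m by (simp add: t)
  ultimately show "t \<in> stirling_perms (Suc n)"
    unfolding stirling_perms_def by blast
qed

text \<open>
  \<open>Phi\<close> by recursion over the word, where \<open>S\<close> is the set of labels read so far.
\<close>
fun relabel :: "nat set \<Rightarrow> nat list \<Rightarrow> nat list" where
  "relabel S [] = []"
| "relabel S (a # w) = (if a \<in> S then 2 * a - 1 else 2 * a) # relabel (insert a S) w"

lemma relabel_eq_map:
  "relabel S w = map (\<lambda>p. if w ! p \<in> S \<union> set (take p w) then 2 * w ! p - 1 else 2 * w ! p)
     [0..<length w]"
proof (induction w arbitrary: S)
  case (Cons a w)
  show ?case
    unfolding relabel.simps Cons list.size(4) add_Suc_right add_0_right map_upt_Suc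
    by (auto simp del: upt_Suc)
qed simp

lemma Phi_eq_relabel: "Phi w = relabel {} w"
  unfolding relabel_eq_map Phi_def by simp

lemma relabel_insert_fresh: "N \<notin> set w \<Longrightarrow> relabel (insert N S) w = relabel S w"
proof (induction w arbitrary: S)
  case (Cons a w)
  then show ?case
    using Cons.IH[of "insert a S"] by (simp add: insert_commute[of a N])
qed simp

text \<open>
  A fresh label has no influence on how the other labels are treated, so relabelling can be done before
  the insertion; the first copy of \<open>N\<close> turns into \<open>2 N\<close>, the second one into \<open>2 N - 1\<close>.
\<close>
lemma relabel_insertions:
  assumes "N \<notin> S" "N \<notin> set w"
  shows "map (relabel S) (insertions [N, N] w) = insertions [2 * N, 2 * N - 1] (relabel S w)"
  using assms
proof (induction w arbitrary: S)
  case (Cons a w)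
  have "map (relabel (insert a S)) (insertions [N, N] w) =
      insertions [2 * N, 2 * N - 1] (relabel (insert a S) w)"
    using Cons.prems by (intro Cons.IH) auto
  moreover have "map (relabel S) (map (Cons a) L) =
      map (Cons (if a \<in> S then 2 * a - 1 else 2 * a)) (map (relabel (insert a S)) L)" for L
    by simp
  ultimately show ?case
    using Cons.prems relabel_insert_fresh[of N "a # w" S]
    by (simp del: map_map)
qed simp

lemma dual_set_Suc:
  "Phi ` stirling_perms (Suc n) =
     (\<Union>w\<in>Phi ` stirling_perms n. set (insertions [2 * n + 2, 2 * n + 1] w))"
proof -
  have "Phi ` set (insertions [n + 1, n + 1] \<sigma>) = set (insertions [2 * n + 2, 2 * n + 1] (Phi \<sigma>))"
    if "\<sigma> \<in> stirling_perms n" for \<sigma>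
  proof -
    have "set_mset (mset \<sigma>) \<subseteq> {..n}"
      using that unfolding stirling_perms_def mem_Collect_eq by (auto simp del: set_mset_mset)
    then have "n + 1 \<notin> set \<sigma>"
      by auto
    then have "map Phi (insertions [n + 1, n + 1] \<sigma>) = insertions [2 * (n + 1), 2 * (n + 1) - 1] (Phi \<sigma>)"
      unfolding Phi_eq_relabel by (intro relabel_insertions) auto
    then show ?thesis
      by (simp flip: set_map)
  qed
  then show ?thesis
    unfolding stirling_perms_Suc by (simp add: image_UN)
qed

lemma dual_set_word:
  assumes "w \<in> Phi ` stirling_perms n"
  shows "length w = 2 * n" "distinct w" "\<forall>x\<in>set w. x < 2 * n + 1" "final_descent w"
proof -
  have "length w = 2 * n \<and> distinct w \<and> (\<forall>x\<in>set w. x < 2 * n + 1) \<and> final_descent w"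
    using assms
  proof (induction n arbitrary: w)
    case 0
    then show ?case by (simp add: stirling_perms_0 Phi_def)
  next
    case (Suc n)
    then obtain v where v: "v \<in> Phi ` stirling_perms n"
      and w: "w \<in> set (insertions [2 * n + 2, 2 * n + 1] v)"
      unfolding dual_set_Suc by blast
    note IH = Suc.IH[OF v]
    have "final_descent w"
      by (rule final_descent_insertions[OF w]) (use IH in auto)
    moreover have "length w = 2 * Suc n" "distinct w" "\<forall>x\<in>set w. x < 2 * Suc n + 1"
    proof -
      obtain x y where "v = x @ y" "w = x @ [2 * n + 2, 2 * n + 1] @ y"
        using w by (auto simp: set_insertions)
      moreover have "2 * n + 1 \<notin> set v" "2 * n + 2 \<notin> set v" "\<forall>x\<in>set v. x < 2 * Suc n + 1"
        using IH by fastforce+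
      ultimately show "length w = 2 * Suc n" "distinct w" "\<forall>x\<in>set w. x < 2 * Suc n + 1"
        using IH by auto
    qed
    ultimately show ?case by blast
  qed
  then show "length w = 2 * n" "distinct w" "\<forall>x\<in>set w. x < 2 * n + 1" "final_descent w"
    by auto
qed

lemma finite_dual_set: "finite (Phi ` stirling_perms n)"
proof (induction n)
  case 0
  then show ?case by (simp add: stirling_perms_0)
next
  case (Suc n)
  then show ?case unfolding dual_set_Suc by (intro finite_UN_I) auto
qed

lemma altrun_dual_insertions:
  assumes "w \<in> Phi ` stirling_perms n" "n \<ge> 1"
  shows "image_mset altrun (mset (insertions [2 * n + 2, 2 * n + 1] w)) =
    add_mset (altrun w + 1) (replicate_mset (altrun w) (altrun w))
      + replicate_mset (2 * n - altrun w) (altrun w + 2)"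
  using altrun_insertions[of w "2 * n + 1" "2 * n + 2"] dual_set_word[OF assms(1)] assms(2) by simp

lemma altrun_dual_range:
  assumes "w \<in> Phi ` stirling_perms n" "n \<ge> 1"
  shows "altrun w \<in> {1..2 * n - 1}"
  using turns_le[of w] dual_set_word(1)[OF assms(1)] assms(2) by (auto simp: altrun_eq_Suc_turns)

lemma dual_set_1: "Phi ` stirling_perms 1 = {[2, 1]}"
  using dual_set_Suc[of 0] by (simp add: stirling_perms_0 Phi_def)

text \<open>
  The values \<open>1, ..., 2 n - 1\<close> survive through insertions that keep the number of runs, and a word with
  \<open>2 n - 1\<close> runs also admits insertions leading to the two new values \<open>2 n\<close> and \<open>2 n + 1\<close>.
\<close>
lemma altrun_dual_surj:
  assumes "n \<ge> 1" "k \<in> {1..2 * n - 1}"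
  shows "\<exists>w\<in>Phi ` stirling_perms n. altrun w = k"
  using assms
proof (induction n arbitrary: k rule: dec_induct)
  case base
  then show ?case unfolding dual_set_1 by (simp add: altrun_eq_Suc_turns)
next
  case (step n)
  have grow: "\<exists>t\<in>Phi ` stirling_perms (Suc n). altrun t = k"
    if j: "j \<in> {1..2 * n - 1}" and k: "k = j \<or> k = j + 1 \<or> k = j + 2" for j
  proof -
    obtain w where w: "w \<in> Phi ` stirling_perms n" "altrun w = j"
      using step.IH j by blast
    have "k \<in># image_mset altrun (mset (insertions [2 * n + 2, 2 * n + 1] w))"
      unfolding altrun_dual_insertions[OF w(1) step.hyps(1)] w(2) using j k by auto
    then show ?thesis
      using w(1) unfolding dual_set_Suc by auto
  qed
  have "k \<in> {1..2 * n - 1} \<or> k = 2 * n - 1 + 1 \<or> k = 2 * n - 1 + 2"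
    using step by auto
  moreover have "2 * n - 1 \<in> {1..2 * n - 1}"
    using step.hyps by auto
  ultimately show ?case
    using grow by blast
qed

section \<open>The generating polynomial of alternating runs\<close>

definition run_poly :: "nat \<Rightarrow> real \<Rightarrow> real" where
  "run_poly n x = (\<Sum>w\<in>Phi ` stirling_perms n. x ^ altrun w)"

definition run_count :: "nat \<Rightarrow> nat \<Rightarrow> nat" where
  "run_count n k = card {w \<in> Phi ` stirling_perms n. altrun w = k}"

lemma run_poly_eq_sum_run_count:
  assumes "n \<ge> 1"
  shows "run_poly n x = (\<Sum>k=1..2 * n - 1. real (run_count n k) * x ^ k)"
proof -
  have "(\<Sum>k=1..2 * n - 1. \<Sum>w | w \<in> Phi ` stirling_perms n \<and> altrun w = k. x ^ altrun w) = run_poly n x"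
    unfolding run_poly_def
  proof (rule sum.group[OF finite_dual_set])
    show "altrun ` Phi ` stirling_perms n \<subseteq> {1..2 * n - 1}"
      using altrun_dual_range[OF _ assms] unfolding image_subset_iff by blast
  qed simp
  then show ?thesis
    by (simp add: run_count_def)
qed

text \<open>
  A word with \<open>k\<close> runs contributes \<open>k x ^ k + x ^ (k + 1) + (2 n - k) x ^ (k + 2)\<close>, in which the two terms
  with coefficients \<open>k\<close> and \<open>- k\<close> make up \<open>x (1 - x\<^sup>2)\<close> times the derivative of \<open>x ^ k\<close>. The first sum is the derivative of \<open>run_poly n\<close>.
\<close>
lemma run_poly_Suc:
  assumes "n \<ge> 1"
  shows "run_poly (Suc n) x =
    x * (1 - x\<^sup>2) * (\<Sum>w\<in>Phi ` stirling_perms n. real (altrun w) * x ^ (altrun w - 1))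
      + x * (1 + 2 * real n * x) * run_poly n x"
proof -
  let ?W = "Phi ` stirling_perms n"
  let ?I = "insertions [2 * n + 2, 2 * n + 1]"
  have recover: "filter (\<lambda>x. x \<le> 2 * n) t = w" if "w \<in> ?W" "t \<in> set (?I w)" for w t
    by (rule filter_insertions[OF that(2)]) (use dual_set_word(3)[OF that(1)] in auto)
  have "run_poly (Suc n) x = (\<Sum>w\<in>?W. \<Sum>t\<in>set (?I w). x ^ altrun t)"
    unfolding run_poly_def dual_set_Suc
  proof (rule sum.UNION_disjoint)
    show "\<forall>v\<in>?W. \<forall>w\<in>?W. v \<noteq> w \<longrightarrow> set (?I v) \<inter> set (?I w) = {}"
    proof (intro ballI impI equals0I)
      fix v w t assume v: "v \<in> ?W" and w: "w \<in> ?W" and "v \<noteq> w"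
        and t: "t \<in> set (?I v) \<inter> set (?I w)"
      have "v = w"
        using recover[OF v, of t] recover[OF w, of t] t by simp
      with \<open>v \<noteq> w\<close> show False ..
    qed
  qed (use finite_dual_set in auto)
  also have "\<dots> = (\<Sum>w\<in>?W. x * (1 - x\<^sup>2) * (real (altrun w) * x ^ (altrun w - 1))
      + x * (1 + 2 * real n * x) * x ^ altrun w)"
  proof (rule sum.cong[OF refl])
    fix w assume w: "w \<in> ?W"
    define k where "k = altrun w"
    have k: "1 \<le> k" "k \<le> 2 * n"
      using altrun_dual_range[OF w assms] by (auto simp: k_def)
    have "distinct (?I w)"
      using dual_set_word(3)[OF w] by (intro distinct_insertions) auto
    then have "(\<Sum>t\<in>set (?I w). x ^ altrun t) = (\<Sum>t\<leftarrow>?I w. x ^ altrun t)"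
      by (simp add: sum_list_distinct_conv_sum_set)
    also have "\<dots> = (\<Sum>j\<in>#image_mset altrun (mset (?I w)). x ^ j)"
      by (simp add: multiset.map_comp o_def flip: sum_mset_sum_list)
    also have "\<dots> = real k * x ^ k + x ^ (k + 1) + real (2 * n - k) * x ^ (k + 2)"
      unfolding altrun_dual_insertions[OF w assms] k_def[symmetric] by simp
    also have "\<dots> = real k * x ^ k + x ^ (k + 1) + (2 * real n - real k) * x ^ (k + 2)"
      using k by (simp add: of_nat_diff)
    also have "\<dots> = x * (1 - x\<^sup>2) * (real k * x ^ (k - 1)) + x * (1 + 2 * real n * x) * x ^ k"
    proof -
      obtain j where "k = Suc j" using k(1) by (cases k) auto
      then show ?thesis by (simp add: algebra_simps power2_eq_square)
    qed
    finally show "(\<Sum>t\<in>set (?I w). x ^ altrun t) =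
        x * (1 - x\<^sup>2) * (real (altrun w) * x ^ (altrun w - 1)) + x * (1 + 2 * real n * x) * x ^ altrun w"
      unfolding k_def .
  qed
  finally show ?thesis
    by (simp add: run_poly_def sum.distrib sum_distrib_left)
qed

section \<open>Iterating the Euler operator on r\<close>

lemma one_minus_square_pos: "x \<in> {-1<..<1::real} \<Longrightarrow> 0 < 1 - x\<^sup>2"
  using abs_square_less_1[of x] by auto

lemma has_derivative_r:
  assumes "x \<in> {-1<..<1::real}"
  shows "(r has_field_derivative r x / (1 - x\<^sup>2)) (at x)"
proof -
  define a b where "a = sqrt (1 + x)" and "b = sqrt (1 - x)"
  have ab: "a > 0" "b > 0" "1 + x = a\<^sup>2" "1 - x = b\<^sup>2"
    using assms by (auto simp: a_def b_def)
  have "1 - x\<^sup>2 = a\<^sup>2 * b\<^sup>2"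
    unfolding ab(3,4)[symmetric] by (simp add: algebra_simps power2_eq_square)
  moreover have "a\<^sup>2 + b\<^sup>2 = 2"
    unfolding ab(3,4)[symmetric] by simp
  then have "(inverse a / 2 * b + a * (inverse b / 2)) / (b * b) = a / b / (a\<^sup>2 * b\<^sup>2)"
    using ab(1,2) by (simp add: field_simps power2_eq_square)
  moreover have "((\<lambda>x. sqrt (1 + x) / sqrt (1 - x)) has_field_derivative
      (inverse a / 2 * b + a * (inverse b / 2)) / (b * b)) (at x)"
    unfolding a_def b_def by (rule derivative_eq_intros refl | use assms in force)+ 
  moreover have "r = (\<lambda>x. sqrt (1 + x) / sqrt (1 - x))"
    by (simp add: fun_eq_iff r_def)
  ultimately show ?thesis
    by (simp add: r_def a_def b_def)
qed

text \<open>
  With \<open>s = 1 - x\<^sup>2\<close>, the quotient rule, \<open>r' = r / s\<close> and \<open>s' = - 2 x\<close> give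
  \<open>x (P r / s ^ n)' = (x s P' + x (1 + 2 n x) P) r / s ^ (n + 1)\<close>, whose numerator is the recurrence of
  the run polynomials. Stating the formula with the factor \<open>r\<close> avoids the half-integral powers of
  \<open>1 - x\<close> and \<open>1 + x\<close> in the definition of \<open>T\<close>.
\<close>
lemma vartheta_power_r:
  assumes "n \<ge> 1" "x \<in> {-1<..<1}"
  shows "(vartheta ^^ n) r x = run_poly n x * r x / (1 - x\<^sup>2) ^ n"
  using assms
proof (induction n arbitrary: x rule: dec_induct)
  case base
  have "run_poly 1 x = x"
    unfolding run_poly_def dual_set_1 by (simp add: altrun_eq_Suc_turns)
  then show ?case
    using DERIV_imp_deriv[OF has_derivative_r[OF base]] by (simp add: vartheta_def)
next
  case (step n)
  note x = step.prems
  define P' where "P' = (\<Sum>w\<in>Phi ` stirling_perms n. real (altrun w) * x ^ (altrun w - 1))"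
  define s where "s = 1 - x\<^sup>2"
  have s: "s > 0"
    unfolding s_def by (rule one_minus_square_pos[OF x])
  have P: "(run_poly n has_field_derivative P') (at x)"
    unfolding run_poly_def[abs_def] P'_def by (auto intro!: derivative_eq_intros sum.cong)
  have "((\<lambda>y. run_poly n y * r y / (1 - y\<^sup>2) ^ n) has_field_derivative
      ((P' * r x + run_poly n x * (r x / s)) * s ^ n
        - run_poly n x * r x * (real n * s ^ (n - 1) * (- 2 * x))) / (s ^ n * s ^ n)) (at x)"
    using s unfolding s_def
    by (auto intro!: derivative_eq_intros P has_derivative_r[OF x])
  then have "((vartheta ^^ n) r has_field_derivative
      ((P' * r x + run_poly n x * (r x / s)) * s ^ n
        - run_poly n x * r x * (real n * s ^ (n - 1) * (- 2 * x))) / (s ^ n * s ^ n)) (at x)"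
    by (rule has_field_derivative_transform_within_open[of _ _ _ "{-1<..<1}"])
      (use x step.IH in auto)
  then have "(vartheta ^^ Suc n) r x = x * (((P' * r x + run_poly n x * (r x / s)) * s ^ n
        - run_poly n x * r x * (real n * s ^ (n - 1) * (- 2 * x))) / (s ^ n * s ^ n))"
    using DERIV_imp_deriv by (fastforce simp: vartheta_def)
  also have "\<dots> = (x * s * P' + x * (1 + 2 * real n * x) * run_poly n x) * r x / s ^ Suc n"
  proof -
    obtain m where "n = Suc m" using step.hyps by (cases n) auto
    then show ?thesis using s by (simp add: field_simps)
  qed
  also have "\<dots> = run_poly (Suc n) x * r x / s ^ Suc n"
    unfolding run_poly_Suc[OF step.hyps(1)] P'_def s_def ..
  finally show ?case
    unfolding s_def .
qed

lemma r_denominator: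
  assumes "n \<ge> 1" "x \<in> {-1<..<1}"
  shows "r x / (1 - x\<^sup>2) ^ n = 1 / ((1 - x) ^ n * (1 + x) ^ (n - 1) * sqrt (1 - x\<^sup>2))"
proof -
  obtain m where n: "n = Suc m" using assms(1) by (cases n) auto
  define a b where "a = sqrt (1 + x)" and "b = sqrt (1 - x)"
  have ab: "a > 0" "b > 0" "1 + x = a\<^sup>2" "1 - x = b\<^sup>2"
    using assms by (auto simp: a_def b_def)
  have factor: "1 - x\<^sup>2 = (1 + x) * (1 - x)"
    by (simp add: algebra_simps power2_eq_square)
  have "sqrt (1 - x\<^sup>2) = a * b"
    unfolding factor a_def b_def by (rule real_sqrt_mult)
  moreover have "1 - x\<^sup>2 = a\<^sup>2 * b\<^sup>2"
    unfolding factor ab(3,4) ..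
  ultimately have "r x / (1 - x\<^sup>2) ^ n = a / b / (a\<^sup>2 * b\<^sup>2) ^ n"
    "1 / ((1 - x) ^ n * (1 + x) ^ (n - 1) * sqrt (1 - x\<^sup>2)) = 1 / ((b\<^sup>2) ^ n * (a\<^sup>2) ^ (n - 1) * (a * b))"
    unfolding r_def a_def[symmetric] b_def[symmetric] by (simp_all only: ab(3,4))
  moreover have "a / b / (a\<^sup>2 * b\<^sup>2) ^ n = 1 / ((b\<^sup>2) ^ n * (a\<^sup>2) ^ (n - 1) * (a * b))"
    using ab(1,2) by (simp add: n field_simps power_mult_distrib power2_eq_square)
  ultimately show ?thesis
    by simp
qed

text \<open>
  Otherwise the difference would be a nonzero polynomial with infinitely many roots.
\<close>
lemma sum_powers_eq_on_interval:
  fixes f g :: "nat \<Rightarrow> real"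
  assumes "\<And>x. x \<in> {a<..<b} \<Longrightarrow> (\<Sum>k\<le>n. f k * x ^ k) = (\<Sum>k\<le>n. g k * x ^ k)"
    and "a < b" "k \<le> n"
  shows "f k = g k"
proof (rule ccontr)
  assume "f k \<noteq> g k"
  then have "finite {x. (\<Sum>k\<le>n. (f k - g k) * x ^ k) = 0}"
    using assms(3) unfolding polyfun_finite_roots by auto
  moreover have "{a<..<b} \<subseteq> {x. (\<Sum>k\<le>n. (f k - g k) * x ^ k) = 0}"
    using assms(1) by (auto simp: left_diff_distrib sum_subtractf)
  ultimately show False
    using assms(2) infinite_Ioo finite_subset by blast
qed

lemma is_T_row_run_count:
  assumes "n \<ge> 1"
  shows "is_T_row n (run_count n)"
  unfolding is_T_row_def
proof (intro conjI ballI allI impI)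
  fix k assume "k \<in> {1..2 * n - 1}"
  then show "0 < run_count n k"
    using altrun_dual_surj[OF assms] finite_dual_set[of n]
    unfolding run_count_def card_gt_0_iff by auto
next
  fix k assume "k \<notin> {1..2 * n - 1}"
  then show "run_count n k = 0"
    using altrun_dual_range[OF _ assms] unfolding run_count_def
    by (metis (mono_tags, lifting) card.empty empty_Collect_eq)
next
  fix x :: real assume x: "x \<in> {-1<..<1}"
  show "(vartheta ^^ n) r x = (\<Sum>k=1..2 * n - 1. real (run_count n k) * x ^ k) /
      ((1 - x) ^ n * (1 + x) ^ (n - 1) * sqrt (1 - x\<^sup>2))"
    using vartheta_power_r[OF assms x] r_denominator[OF assms x] run_poly_eq_sum_run_count[OF assms]
    by (metis mult.right_neutral times_divide_eq_right)
qed

lemma is_T_row_unique: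
  assumes "is_T_row n t" "is_T_row n t'"
  shows "t = t'"
proof
  fix k
  show "t k = t' k"
  proof (cases "k \<in> {1..2 * n - 1}")
    case True
    have low: "(\<Sum>k=1..2 * n - 1. real (u k) * x ^ k) = (\<Sum>k\<le>2 * n - 1. real (u k) * x ^ k)"
      if "is_T_row n u" for u and x :: real
      using that unfolding is_T_row_def by (intro sum.mono_neutral_left) auto
    have "(\<Sum>k\<le>2 * n - 1. real (t k) * x ^ k) = (\<Sum>k\<le>2 * n - 1. real (t' k) * x ^ k)"
      if x: "x \<in> {-1<..<1}" for x
    proof -
      have "(1 - x) ^ n * (1 + x) ^ (n - 1) * sqrt (1 - x\<^sup>2) \<noteq> 0"
        using x one_minus_square_pos[OF x] by auto
      then show ?thesis
        using assms x unfolding low[OF assms(1), symmetric] low[OF assms(2), symmetric]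
        by (auto simp: is_T_row_def)
    qed
    then have "real (t k) = real (t' k)"
      by (rule sum_powers_eq_on_interval) (use True in auto)
    then show ?thesis by simp
  next
    case False
    then show ?thesis using assms by (simp add: is_T_row_def)
  qed
qed

theorem theorem1:
  fixes n k :: nat
  assumes "1 \<le> n" and "1 \<le> k" and "k \<le> 2 * n - 1"
  shows "T n k = card {\<pi> \<in> Phi ` stirling_perms n. altrun \<pi> = k}"
proof -
  have "T n = run_count n"
    unfolding T_def
    by (rule the_equality[of "is_T_row n"])
      (use is_T_row_run_count[OF assms(1)] is_T_row_unique in blast)+
  then show ?thesis
    by (simp add: run_count_def)
qed

end
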